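(* Let $\mathcal{C}$ be a class of clause-sets with $\mathcal{VMU} \cap \mathcal{SED} \subseteq \mathcal{C} \subseteq \mathcal{LEAN}$, and let $k \in \mathbb{N}$. Then $\mathrm{minvdeg}(\mathcal{C}_{\delta = k}) = \mathrm{N}(k)$, where $\mathcal{C}_{\delta=k} = \{F \in \mathcal{C} : \delta(F) = k\}$.
   Context: Literals come with a fixed-point-free involution $x \mapsto \overline{x}$; variables are the positive literals. A clause is a finite set $C$ of literals with $C \cap \overline{C} = \emptyset$; a clause-set is a finite set of clauses. For a clause-set $F$: $\mathrm{var}(F)$ its variables, $n(F) = |\mathrm{var}(F)|$, $c(F) = |F|$, $\delta(F) = c(F) - n(F)$; $\mathrm{ld}_F(x)$ is the number of clauses containing literal $x$, $\mathrm{vdeg}_F(v) = \mathrm{ld}_F(v) + \mathrm{ld}_F(\overline{v})$, $\mathrm{minvdeg}(F) = \min_{v \in \mathrm{var}(F)} \mathrm{vdeg}_F(v)$ for $n(F)>0$. For a class $\mathcal{D}$ of clause-sets, $\mathrm{minvdeg}(\mathcal{D}) \in \mathbb{N}_0 \cup \{+\infty\}$ is the supremum of $\mathrm{minvdeg}(F)$ over $F \in \mathcal{D}$ with $n(F) > 0$, and $0$ if there is no such $F$. The surplus $\sigma(F)$ is $\min_{\emptyset \ne V \subseteq \mathrm{var}(F)} (|\{C \in F : \mathrm{var}(C) \cap V \ne \emptyset\}| - |V|)$ for $n(F) > 0$ and $0$ otherwise. A partial assignment is a map $\varphi : V \to \{0,1\}$ on a finite set $V$ of variables ($\varphi(\overline{v})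 = 1-\varphi(v)$); $F$ is satisfiable iff some partial assignment satisfies (makes true some literal of) every clause. An autarky for $F$ is a partial assignment $\varphi$ such that every clause of $F$ containing a literal falsified by $\varphi$ contains a literal satisfied by $\varphi$. $\mathcal{LEAN}$ is the class of clause-sets $F$ having no autarky $\varphi$ with $\mathrm{var}(\varphi) \cap \mathrm{var}(F) \ne \emptyset$. $\mathcal{VMU}$ (variable-minimally unsatisfiable) is the class of unsatisfiable $F$ such that every unsatisfiable $F' \subseteq F$ has $\mathrm{var}(F') = \mathrm{var}(F)$. $\mathcal{SED}$ is the class of clause-sets $F$ with $\sigma(F) = \delta(F)$. $\mathrm{N} : \mathbb{N} \to \mathbb{N}$ is defined by $\mathrm{N}(1) = 2$ and $\mathrm{N}(k) = \max_{i \in \{2,\dots,k\}} \min(2i, \mathrm{N}(k-i+1)+i)$ for $k \ge 2$. *)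

theory Defs
  imports Main "HOL-Library.Extended_Nat"
begin

datatype lit = Pos nat | Neg nat

fun comp :: "lit \<Rightarrow> lit" where
  "comp (Pos v) = Neg v"
| "comp (Neg v) = Pos v"

fun lvar :: "lit \<Rightarrow> nat" where
  "lvar (Pos v) = v"
| "lvar (Neg v) = v"

type_synonym clause = "lit set"
type_synonym cls = "clause set"

definition is_clause :: "clause \<Rightarrow> bool" where
  "is_clause C \<longleftrightarrow> finite C \<and> C \<inter> comp ` C = {}"

definition is_clauseset :: "cls \<Rightarrow> bool" where
  "is_clauseset F \<longleftrightarrow> finite F \<and> (\<forall>C\<in>F. is_clause C)"

definition cvar :: "clause \<Rightarrow> nat set" where
  "cvar C = lvar ` C"

definition var :: "cls \<Rightarrow> nat set" where
  "var F = (\<Union>C\<in>F. cvar C)"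

definition nvar :: "cls \<Rightarrow> nat" where
  "nvar F = card (var F)"

definition ncl :: "cls \<Rightarrow> nat" where
  "ncl F = card F"

definition deficiency :: "cls \<Rightarrow> int" where
  "deficiency F = int (ncl F) - int (nvar F)"

definition ld :: "cls \<Rightarrow> lit \<Rightarrow> nat" where
  "ld F x = card {C\<in>F. x \<in> C}"

definition vdeg :: "cls \<Rightarrow> nat \<Rightarrow> nat" where
  "vdeg F v = ld F (Pos v) + ld F (Neg v)"

text \<open>Only meaningful for n(F) > 0.\<close>
definition minvdeg :: "cls \<Rightarrow> nat" where
  "minvdeg F = Min (vdeg F ` var F)"

text \<open>minvdeg of a class: supremum in N_0 \<union> {+\<infinity>} (enat); Sup {} = 0.\<close>
definition minvdeg_class :: "cls set \<Rightarrow> enat" where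
  "minvdeg_class D = Sup {enat (minvdeg F) | F. F \<in> D \<and> nvar F > 0}"

definition surplus :: "cls \<Rightarrow> int" where
  "surplus F = (if nvar F = 0 then 0 else
     Min {int (card {C\<in>F. cvar C \<inter> V \<noteq> {}}) - int (card V) | V. V \<noteq> {} \<and> V \<subseteq> var F})"

definition is_pass :: "(nat \<rightharpoonup> bool) \<Rightarrow> bool" where
  "is_pass \<phi> \<longleftrightarrow> finite (dom \<phi>)"

fun lit_sat :: "(nat \<rightharpoonup> bool) \<Rightarrow> lit \<Rightarrow> bool" where
  "lit_sat \<phi> (Pos v) \<longleftrightarrow> \<phi> v = Some True"
| "lit_sat \<phi> (Neg v) \<longleftrightarrow> \<phi> v = Some False"

fun lit_fals :: "(nat \<rightharpoonup> bool) \<Rightarrow> lit \<Rightarrow> bool" where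
  "lit_fals \<phi> (Pos v) \<longleftrightarrow> \<phi> v = Some False"
| "lit_fals \<phi> (Neg v) \<longleftrightarrow> \<phi> v = Some True"

definition satisfiable :: "cls \<Rightarrow> bool" where
  "satisfiable F \<longleftrightarrow> (\<exists>\<phi>. is_pass \<phi> \<and> (\<forall>C\<in>F. \<exists>x\<in>C. lit_sat \<phi> x))"

definition autarky :: "(nat \<rightharpoonup> bool) \<Rightarrow> cls \<Rightarrow> bool" where
  "autarky \<phi> F \<longleftrightarrow> is_pass \<phi> \<and>
     (\<forall>C\<in>F. (\<exists>x\<in>C. lit_fals \<phi> x) \<longrightarrow> (\<exists>x\<in>C. lit_sat \<phi> x))"

definition LEAN :: "cls set" where
  "LEAN = {F. is_clauseset F \<and> \<not> (\<exists>\<phi>. autarky \<phi> F \<and> dom \<phi> \<inter> var F \<noteq> {})}"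

definition VMU :: "cls set" where
  "VMU = {F. is_clauseset F \<and> \<not> satisfiable F \<and>
            (\<forall>F'. F' \<subseteq> F \<and> \<not> satisfiable F' \<longrightarrow> var F' = var F)}"

definition SED :: "cls set" where
  "SED = {F. is_clauseset F \<and> surplus F = deficiency F}"

function Nfun :: "nat \<Rightarrow> nat" where
  "Nfun k = (if k \<le> 1 then 2
             else Max ((\<lambda>i. min (2 * i) (Nfun (k - i + 1) + i)) ` {2..k}))"
  by pat_completeness auto
termination
  by (relation "measure id") auto

end

theory Submission
  imports Defs
begin

text \<open>
  Upper bound. The argument works with pairs \<open>(F, V)\<close>, meaning the multi-clause-set obtained by
  restricting every clause of \<open>F\<close> to the variables \<open>V\<close> and dropping empty results; this keeps
  leanness and the degrees of the variables in \<open>V\<close>. By induction on \<open>|V|\<close> one may assume that every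
  proper nonempty \<open>W \<subset> V\<close> is touched by more than \<open>|W| + k\<close> clauses, where \<open>k\<close> is the deficiency of
  the pair: otherwise \<open>(F, W)\<close> is a smaller pair of deficiency at most \<open>k\<close>. Set the more frequent literal
  \<open>x\<close> of some variable true, \<open>e\<close> being its degree. A nonempty autarky for the result would leave, by counting,
  either no clause, so that the whole of \<open>V\<close> would carry an autarky, or a nonempty lean pair of deficiency
  at most \<open>0\<close>, which is impossible by Hall's theorem. So the result is lean of deficiency at most
  \<open>k - e + 1\<close>, and the bound is \<open>min (2 * e) (Nfun (k - e + 1) + e)\<close>.

  Lower bound. Choose \<open>n\<close> with \<open>2 ^ n \<le> k + n \<le> 2 ^ (n + 1) - 2\<close>. On the variables \<open>0, \<dots>, n\<close> take the
  unit clause \<open>{Neg 0}\<close> and \<open>k + n\<close> full clauses, including all \<open>2 ^ n\<close> containing \<open>Pos 0\<close>. Every variable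
  occurs in all full clauses, and \<open>Nfun k \<le> k + n\<close>.
\<close>

subsection \<open>Non-Mersenne numbers\<close>

declare Nfun.simps [simp del]

lemma Nfun_1 [simp]: "Nfun (Suc 0) = 2"
  by (simp add: Nfun.simps)

lemma Nfun_ge:
  assumes "2 \<le> i" "i \<le> k"
  shows "min (2 * i) (Nfun (k - i + 1) + i) \<le> Nfun k"
  using assms by (subst (2) Nfun.simps) (auto intro!: Max_ge)

lemma Nfun_le:
  assumes "2 \<le> k" "\<And>i. 2 \<le> i \<Longrightarrow> i \<le> k \<Longrightarrow> min (2 * i) (Nfun (k - i + 1) + i) \<le> m"
  shows "Nfun k \<le> m"
  using assms by (subst Nfun.simps) auto

text \<open>For \<open>k > 1\<close> the index \<open>i = k\<close> already contributes
  \<open>min (2 * k) (k + 2)\<close>, because \<open>Nfun 1 = 2\<close>.\<close>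

lemma Nfun_ge_Suc: "1 \<le> k \<Longrightarrow> k + 1 \<le> Nfun k"
  using Nfun_ge[of k k] by (cases "k = 1") auto

text \<open>The two maxima are compared term by term: every index for \<open>k\<close> is admissible
  for \<open>Suc k\<close>, and its recursive argument \<open>k - i + 1 < k\<close> only grows by
  one.\<close>

lemma Nfun_le_Suc: "1 \<le> k \<Longrightarrow> Nfun k \<le> Nfun (Suc k)"
proof (induction k rule: less_induct)
  case (less k)
  show ?case
  proof (cases "k = 1")
    case True
    then show ?thesis using Nfun_ge_Suc[of "Suc k"] by simp
  next
    case False
    with less.prems have "2 \<le> k" by simp
    then show ?thesis
    proof (rule Nfun_le)
      fix i assume i: "2 \<le> i" "i \<le> k"
      then have "Nfun (k - i + 1) \<le> Nfun (Suc k - i + 1)"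
        using less.IH[of "k - i + 1"] by (simp add: Suc_diff_le)
      then show "min (2 * i) (Nfun (k - i + 1) + i) \<le> Nfun (Suc k)"
        using Nfun_ge[of i "Suc k"] i by linarith
    qed
  qed
qed

lemma Nfun_mono:
  assumes "1 \<le> j" "j \<le> k"
  shows "Nfun j \<le> Nfun k"
  using assms(2,1)
proof (induction k rule: dec_induct)
  case (step m)
  then show ?case using Nfun_le_Suc[of m] by simp
qed simp

text \<open>An index with \<open>2 * i > k + n\<close> reduces to \<open>k - i + 1\<close> and
  \<open>n - 1\<close>, whose bound plus \<open>i\<close> is again \<open>k + n\<close>.\<close>

lemma Nfun_le_add:
  assumes "1 \<le> k" "1 \<le> n" "k + n + 2 \<le> 2 ^ (n + 1)"
  shows "Nfun k \<le> k + n"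
  using assms
proof (induction k arbitrary: n rule: less_induct)
  case (less k)
  show ?case
  proof (cases "k = 1")
    case True
    then show ?thesis using less.prems by simp
  next
    case False
    with less.prems have "2 \<le> k" by simp
    then show ?thesis
    proof (rule Nfun_le)
      fix i assume i: "2 \<le> i" "i \<le> k"
      show "min (2 * i) (Nfun (k - i + 1) + i) \<le> k + n"
      proof (cases "2 * i \<le> k + n")
        case False
        have "n \<noteq> 1" using less.prems \<open>2 \<le> k\<close> by auto
        then obtain m where m: "n = Suc m" "1 \<le> m" using less.prems by (cases n) auto
        \<comment> \<open>Since \<open>2 * i\<close> is at least \<open>k + n + 1\<close>, the left
          side is at most \<open>2 ^ (n + 1) + 1\<close>; the excess of one vanishes by parity on
          halving.\<close>
        have "2 * (k - i + 1 + m + 2) < 2 * 2 ^ (m + 1) + 2"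
          using less.prems(3) False i m by simp
        then have "Nfun (k - i + 1) \<le> k - i + 1 + m"
          using less.IH[of "k - i + 1" m] i m by simp
        then show ?thesis using i m by simp
      qed simp
    qed
  qed
qed

subsection \<open>Hall's theorem\<close>

text \<open>Induction on \<open>card I\<close>. If some proper nonempty \<open>J\<close> is tight,
  \<open>J\<close> and its complement are matched separately; otherwise one arbitrary choice can be
  fixed without breaking the condition.\<close>

theorem hall:
  fixes A :: "'a \<Rightarrow> 'b set"
  assumes "finite I" "\<And>i. i \<in> I \<Longrightarrow> finite (A i)"
    and "\<And>J. J \<subseteq> I \<Longrightarrow> card J \<le> card (\<Union> (A ` J))"
  shows "\<exists>f. inj_on f I \<and> (\<forall>i\<in>I. f i \<in> A i)"
  using assms
proof (induction "card I" arbitrary: I A rule: less_induct)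
  case less
  note fin = less.prems(1,2) and hall = less.prems(3)
  have finU: "finite (\<Union> (A ` J))" if "J \<subseteq> I" for J
    using fin that by (auto dest: finite_subset)
  show ?case
  proof (cases "\<exists>J. J \<subset> I \<and> J \<noteq> {} \<and> card (\<Union> (A ` J)) = card J")
    case True
    then obtain J where J: "J \<subset> I" "J \<noteq> {}" "card (\<Union> (A ` J)) = card J" by blast
    let ?X = "\<Union> (A ` J)"
    have finJ: "finite J" using J fin finite_subset by blast
    have "\<exists>f. inj_on f J \<and> (\<forall>i\<in>J. f i \<in> A i)"
      using J fin hall by (intro less.hyps psubset_card_mono finJ) auto
    then obtain f where f: "inj_on f J" "\<forall>i\<in>J. f i \<in> A i" by blast
    \<comment> \<open>Outside a tight \<open>J\<close> the elements of \<open>?X\<close> may be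
      discarded: the condition for \<open>K \<union> J\<close> minus the equality for
      \<open>J\<close> is the condition for \<open>K\<close>.\<close>
    have "\<exists>g. inj_on g (I - J) \<and> (\<forall>i\<in>I - J. g i \<in> A i - ?X)"
    proof (rule less.hyps)
      show "card (I - J) < card I" using J fin by (intro psubset_card_mono) auto
      fix K assume K: "K \<subseteq> I - J"
      have finK: "finite K" using K fin finite_subset by blast
      have "card (K \<union> J) \<le> card (\<Union> (A ` (K \<union> J)))" using K J by (intro hall) auto
      also have "\<Union> (A ` (K \<union> J)) = (\<Union>i\<in>K. A i - ?X) \<union> ?X" by auto
      also have "card \<dots> = card (\<Union>i\<in>K. A i - ?X) + card ?X"
        using K J finU[of J] finU[of K] by (intro card_Un_disjoint) (auto elim: rev_finite_subset)
      finally show "card K \<le> card (\<Union>i\<in>K. A i - ?X)"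
        using J K finK finJ by (subst (asm) card_Un_disjoint) auto
    qed (use fin in auto)
    then obtain g where g: "inj_on g (I - J)" "\<forall>i\<in>I - J. g i \<in> A i - ?X" by blast
    let ?h = "\<lambda>i. if i \<in> J then f i else g i"
    have "?h ` J \<inter> ?h ` (I - J) = {}" using f g by force
    moreover have "inj_on ?h J" "inj_on ?h (I - J)"
      using f(1) g(1) by (simp_all add: inj_on_def)
    ultimately have "inj_on ?h (J \<union> (I - J))"
      by (subst inj_on_Un) (auto simp: Diff_Diff_Int)
    moreover have "J \<union> (I - J) = I" using J by blast
    moreover have "\<forall>i\<in>I. ?h i \<in> A i" using f g by auto
    ultimately show ?thesis by (intro exI[of _ ?h]) simp
  next
    case False
    show ?thesis
    proof (cases "I = {}")
      case False
      then obtain i where i: "i \<in> I" by blast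
      have "A i \<noteq> {}" using hall[of "{i}"] i by auto
      then obtain a where a: "a \<in> A i" by blast
      have "\<exists>g. inj_on g (I - {i}) \<and> (\<forall>j\<in>I - {i}. g j \<in> A j - {a})"
      proof (rule less.hyps)
        show "card (I - {i}) < card I" using i fin by (intro psubset_card_mono) auto
        fix K assume K: "K \<subseteq> I - {i}"
        show "card K \<le> card (\<Union>j\<in>K. A j - {a})"
        proof (cases "K = {}")
          case False
          have "card K \<le> card (\<Union> (A ` K))" using K by (intro hall) auto
          \<comment> \<open>No proper nonempty subset is tight, so \<open>K\<close> has an element
            to spare and can afford to lose \<open>a\<close>.\<close>
          moreover have "card (\<Union> (A ` K)) \<noteq> card K"
            using \<open>\<not> (\<exists>J. _ J)\<close> False K i by blast
          moreover have "(\<Union>j\<in>K. A j - {a}) = \<Union> (A ` K) - {a}" by auto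
          moreover have "card (\<Union> (A ` K)) - 1 \<le> card (\<Union> (A ` K) - {a})"
            by (simp add: card_Diff_singleton_if)
          ultimately show ?thesis by simp
        qed simp
      qed (use fin in auto)
      then obtain g where g: "inj_on g (I - {i})" "\<forall>j\<in>I - {i}. g j \<in> A j - {a}" by blast
      have "inj_on (g(i := a)) (insert i (I - {i}))"
        using g by (auto simp: inj_on_def)
      then show ?thesis using g a i by (intro exI[of _ "g(i := a)"]) (auto simp: insert_absorb)
    qed auto
  qed
qed

subsection \<open>The upper bound for lean clause-sets\<close>

definition touch :: "cls \<Rightarrow> nat set \<Rightarrow> cls" where
  "touch F V = {C \<in> F. cvar C \<inter> V \<noteq> {}}"

definition makes_true :: "(nat \<Rightarrow> bool) \<Rightarrow> lit \<Rightarrow> bool" where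
  "makes_true f x \<longleftrightarrow> (case x of Pos v \<Rightarrow> f v | Neg v \<Rightarrow> \<not> f v)"

lemma makes_true_simps [simp]:
  "makes_true f (Pos v) \<longleftrightarrow> f v" "makes_true f (Neg v) \<longleftrightarrow> \<not> f v"
  by (simp_all add: makes_true_def)

lemma makes_true_cong: "f (lvar x) = g (lvar x) \<Longrightarrow> makes_true f x = makes_true g x"
  by (cases x) auto

text \<open>This encodes an autarky with domain exactly \<open>W\<close>: the valuation is total,
  but only its values on \<open>W\<close> count. Every clause meeting \<open>W\<close> has a literal
  that is assigned, so all such clauses must be satisfied.\<close>

definition autarky_on :: "cls \<Rightarrow> nat set \<Rightarrow> bool" where
  "autarky_on F W \<longleftrightarrow> (\<exists>f. \<forall>C\<in>touch F W. \<exists>x\<in>C. lvar x \<in> W \<and> makes_true f x)"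

definition lean_on :: "cls \<Rightarrow> nat set \<Rightarrow> bool" where
  "lean_on F V \<longleftrightarrow> (\<forall>W. W \<subseteq> V \<and> W \<noteq> {} \<longrightarrow> \<not> autarky_on F W)"

lemma touch_subset: "touch F V \<subseteq> F"
  by (auto simp: touch_def)

lemma touch_mono: "V \<subseteq> W \<Longrightarrow> touch F V \<subseteq> touch F W"
  by (auto simp: touch_def)

lemma finite_touch [simp]: "finite F \<Longrightarrow> finite (touch F V)"
  by (simp add: touch_def)

lemma lean_on_subset: "lean_on F V \<Longrightarrow> W \<subseteq> V \<Longrightarrow> lean_on F W"
  by (auto simp: lean_on_def)

text \<open>If at most \<open>card V\<close> clauses were touched, Hall's theorem would assign to
  each of them its own variable in \<open>V\<close>, and satisfying each clause through its variable
  would be an autarky.\<close>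

lemma lean_on_card:
  assumes "finite F" "finite V" "V \<noteq> {}" "lean_on F V"
  shows "card V < card (touch F V)"
  using assms(2-)
proof (induction "card V" arbitrary: V rule: less_induct)
  case less
  show ?case
  proof (rule ccontr)
    assume "\<not> ?thesis"
    then have le: "card (touch F V) \<le> card V" by simp
    have "\<exists>m. inj_on m (touch F V) \<and> (\<forall>C\<in>touch F V. m C \<in> cvar C \<inter> V)"
    proof (rule hall)
      fix S assume S: "S \<subseteq> touch F V"
      let ?N = "\<Union>C\<in>S. cvar C \<inter> V"
      show "card S \<le> card ?N"
      proof (cases "S = {}")
        case False
        then have "?N \<noteq> {}" using S by (auto simp: touch_def)
        then have sub: "V - ?N \<subset> V" by auto
        then have less': "card (V - ?N) < card V"
          using less.prems by (intro psubset_card_mono) auto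
        \<comment> \<open>Hall's condition for \<open>S\<close> comes from the complement: clauses
          touching \<open>V - ?N\<close> lie outside \<open>S\<close>, and the induction hypothesis
          says that there are at least \<open>card (V - ?N)\<close> of them.\<close>
        have "card (V - ?N) \<le> card (touch F (V - ?N))"
        proof (cases "V - ?N = {}")
          case False
          then show ?thesis
            using less.hyps[OF less'] less.prems lean_on_subset[of F V "V - ?N"] by auto
        qed (simp only: card.empty)
        also have "\<dots> \<le> card (touch F V - S)"
          using assms(1) by (intro card_mono) (auto simp: touch_def)
        also have "\<dots> = card (touch F V) - card S"
          using S assms(1) by (intro card_Diff_subset) (auto intro: finite_subset)
        also have "card (V - ?N) = card V - card ?N"
          using less.prems by (intro card_Diff_subset) (auto elim: rev_finite_subset)
        finally have "card V - card ?N \<le> card (touch F V) - card S" .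
        moreover have "card ?N \<le> card V" using less.prems by (intro card_mono) auto
        moreover have "card S \<le> card (touch F V)" using S assms(1) by (intro card_mono) auto
        ultimately show ?thesis using le by linarith
      qed simp
    qed (use assms(1) less.prems in auto)
    then obtain m where m: "inj_on m (touch F V)" "\<And>C. C \<in> touch F V \<Longrightarrow> m C \<in> cvar C \<inter> V"
      by blast
    \<comment> \<open>Each matched variable gets the sign it has in its clause; injectivity of
      \<open>m\<close> excludes conflicts.\<close>
    define f where "f v \<longleftrightarrow> (\<exists>C\<in>touch F V. m C = v \<and> Pos v \<in> C)" for v
    have "\<exists>x\<in>C. lvar x \<in> V \<and> makes_true f x" if C: "C \<in> touch F V" for C
    proof -
      from m(2)[OF C] obtain x where x: "x \<in> C" "lvar x = m C" "m C \<in> V"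
        by (auto simp: cvar_def)
      show ?thesis
      proof (cases "Pos (m C) \<in> C")
        case True
        then have "f (m C)" using C by (auto simp: f_def)
        then show ?thesis using True x(3) by (intro bexI[of _ "Pos (m C)"]) auto
      next
        case False
        then have "\<not> f (m C)" using C m(1) by (auto simp: f_def dest: inj_onD)
        moreover have "x = Neg (m C)" using False x by (cases x) auto
        ultimately show ?thesis using x by (intro bexI[of _ x]) auto
      qed
    qed
    then have "autarky_on F V" by (auto simp: autarky_on_def)
    then show False using less.prems by (auto simp: lean_on_def)
  qed
qed

text \<open>Composition of autarkies: the clauses left over after the first contain no variable of
  \<open>W\<close>, so the two valuations can be glued. This makes the residue of a maximal autarky
  lean.\<close>

lemma autarky_on_Un:
  assumes "autarky_on F W" "autarky_on (F - touch F W) W'" "W \<inter> W' = {}"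
  shows "autarky_on F (W \<union> W')"
proof -
  obtain f where f: "\<And>C. C \<in> touch F W \<Longrightarrow> \<exists>x\<in>C. lvar x \<in> W \<and> makes_true f x"
    using assms(1) by (auto simp: autarky_on_def)
  obtain g where g: "\<And>C. C \<in> touch (F - touch F W) W' \<Longrightarrow> \<exists>x\<in>C. lvar x \<in> W' \<and> makes_true g x"
    using assms(2) by (auto simp: autarky_on_def)
  define h where "h v = (if v \<in> W then f v else g v)" for v
  have "\<exists>x\<in>C. lvar x \<in> W \<union> W' \<and> makes_true h x" if C: "C \<in> touch F (W \<union> W')" for C
  proof (cases "C \<in> touch F W")
    case True
    then obtain x where "x \<in> C" "lvar x \<in> W" "makes_true f x" using f by blast
    then show ?thesis using makes_true_cong[of f x h] by (auto simp: h_def)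
  next
    case False
    then have "C \<in> touch (F - touch F W) W'" using C by (auto simp: touch_def)
    then obtain x where "x \<in> C" "lvar x \<in> W'" "makes_true g x" using g by blast
    moreover from this have "lvar x \<notin> W" using assms(3) by auto
    ultimately show ?thesis using makes_true_cong[of g x h] by (auto simp: h_def)
  qed
  then show ?thesis by (auto simp: autarky_on_def)
qed

text \<open>A clause has no complementary literals, so no clause is counted twice in the
  degree.\<close>

lemma vdeg_eq_card_touch:
  assumes "is_clauseset F"
  shows "vdeg F v = card (touch F {v})"
proof -
  have "touch F {v} = {C \<in> F. Pos v \<in> C} \<union> {C \<in> F. Neg v \<in> C}"
  proof -
    have "v \<in> cvar C \<longleftrightarrow> Pos v \<in> C \<or> Neg v \<in> C" for C
      by (metis (no_types, lifting) cvar_def image_iff lvar.elims lvar.simps)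
    then show ?thesis by (auto simp: touch_def)
  qed
  moreover have "{C \<in> F. Pos v \<in> C} \<inter> {C \<in> F. Neg v \<in> C} = {}"
  proof -
    have "\<not> (Pos v \<in> C \<and> Neg v \<in> C)" if "C \<in> F" for C
      using assms that by (force simp: is_clauseset_def is_clause_def)
    then show ?thesis by blast
  qed
  moreover have "finite F" using assms by (simp add: is_clauseset_def)
  ultimately show ?thesis by (simp add: vdeg_def ld_def card_Un_disjoint)
qed

lemma lean_on_min_vdeg:
  assumes "is_clauseset F" "finite V" "V \<noteq> {}" "lean_on F V"
  shows "\<exists>v\<in>V. vdeg F v \<le> Nfun (card (touch F V) - card V)"
  using assms
proof (induction "card V" arbitrary: F V rule: less_induct)
  case less
  note F = less.prems(1) and finV = less.prems(2) and lean = less.prems(4)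
  have finF: "finite F" using F by (simp add: is_clauseset_def)
  define k where "k = card (touch F V) - card V"
  have cardT: "card (touch F V) = card V + k" and k: "1 \<le> k"
    using lean_on_card[OF finF finV less.prems(3) lean] by (auto simp: k_def)
  show ?case unfolding k_def[symmetric]
  proof (cases "\<exists>W. W \<subset> V \<and> W \<noteq> {} \<and> card (touch F W) \<le> card W + k")
    case True
    then obtain W where W: "W \<subset> V" "W \<noteq> {}" "card (touch F W) \<le> card W + k" by blast
    have finW: "finite W" and leanW: "lean_on F W"
      using W finV lean by (auto intro: finite_subset lean_on_subset)
    have "card W < card V" using W finV by (simp add: psubset_card_mono)
    from less.hyps[OF this F finW W(2) leanW]
    obtain v where v: "v \<in> W" "vdeg F v \<le> Nfun (card (touch F W) - card W)" by blast
    \<comment> \<open>The deficiency of \<open>(F, W)\<close> lies between 1 and \<open>k\<close>;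
      the lower end is needed for monotonicity of \<open>Nfun\<close>.\<close>
    moreover have "Nfun (card (touch F W) - card W) \<le> Nfun k"
      using W(3) lean_on_card[OF finF finW W(2) leanW] by (intro Nfun_mono) auto
    ultimately show "\<exists>v\<in>V. vdeg F v \<le> Nfun k" using W by (auto intro: order_trans)
  next
    case False
    then have surplus: "card W + k + 1 \<le> card (touch F W)" if "W \<subset> V" "W \<noteq> {}" for W
      using that by (metis Suc_eq_plus1 not_less_eq_eq)
    obtain v where v: "v \<in> V" using less.prems(3) by blast
    define x where "x = (if ld F (Neg v) \<le> ld F (Pos v) then Pos v else Neg v)"
    have x: "lvar x = v" "vdeg F v \<le> 2 * ld F x" by (auto simp: x_def vdeg_def)
    define F' where "F' = {C \<in> F. x \<notin> C}"
    define U where "U = V - {v}"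
    have F': "is_clauseset F'" "finite F'" using F by (auto simp: F'_def is_clauseset_def)
    have U: "finite U" "card V = Suc (card U)" "U \<subset> V"
      using finV v card.remove[OF finV v] by (auto simp: U_def)
    show "\<exists>v\<in>V. vdeg F v \<le> Nfun k"
    proof (cases "U = {}")
      case True
      then have "V = {v}" using v by (auto simp: U_def)
      then show ?thesis
        using cardT Nfun_ge_Suc[OF k] vdeg_eq_card_touch[OF F, of v] by simp
    next
      case False
      have "lean_on F' U"
      proof (rule ccontr)
        define S where "S = {W. W \<subseteq> U \<and> W \<noteq> {} \<and> autarky_on F' W}"
        assume "\<not> lean_on F' U"
        then have "S \<noteq> {}" by (auto simp: S_def lean_on_def)
        moreover have "finite S" using U by (simp add: S_def)
        \<comment> \<open>Maximality is what later makes the part not reached by the autarky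
          lean.\<close>
        ultimately obtain W where W: "W \<in> S" "\<And>W'. W' \<in> S \<Longrightarrow> W \<subseteq> W' \<Longrightarrow> W' = W"
          using finite_has_maximal[of S] by blast
        then have WU: "W \<subseteq> U" "W \<noteq> {}" and autW: "autarky_on F' W" by (auto simp: S_def)
        have sW: "card W + k + 1 \<le> card (touch F W)" using WU U by (intro surplus) auto
        show False
        proof (cases "W = U")
          case True
          \<comment> \<open>With \<open>W = U\<close> the surplus bound equals
            \<open>card V + k\<close>, so every clause touching \<open>V\<close> also touches
            \<open>U\<close>. Setting \<open>x\<close> true then extends the autarky to all of
            \<open>V\<close>.\<close>
          have "touch F U = touch F V"
            using sW True U cardT finF by (intro card_seteq touch_mono) auto
          from autW obtain f where
            f: "\<And>C. C \<in> touch F' U \<Longrightarrow> \<exists>y\<in>C. lvar y \<in> U \<and> makes_true f y"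
            using True by (auto simp: autarky_on_def)
          let ?g = "f(v := (x = Pos v))"
          have "\<exists>y\<in>C. lvar y \<in> V \<and> makes_true ?g y" if C: "C \<in> touch F V" for C
          proof (cases "x \<in> C")
            case True
            then show ?thesis using v by (intro bexI[of _ x]) (auto simp: x_def)
          next
            case False
            then have "C \<in> touch F' U"
              using C \<open>touch F U = touch F V\<close> by (auto simp: touch_def F'_def)
            then obtain y where "y \<in> C" "lvar y \<in> U" "makes_true f y" using f by blast
            then show ?thesis using makes_true_cong[of f y ?g] U by (auto simp: U_def)
          qed
          then have "autarky_on F V" by (auto simp: autarky_on_def)
          then show False using lean v by (auto simp: lean_on_def)
        next
          case False
          let ?G = "F' - touch F' W"
          have "lean_on ?G (U - W)"
            unfolding lean_on_def
          proof (intro allI impI notI)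
            fix W' assume W': "W' \<subseteq> U - W \<and> W' \<noteq> {}" "autarky_on ?G W'"
            then have "autarky_on F' (W \<union> W')" by (intro autarky_on_Un autW) auto
            then have "W \<union> W' = W" using W' WU by (intro W(2)) (auto simp: S_def)
            then show False using W' by auto
          qed
          \<comment> \<open>Positive deficiency of the residue contradicts the surplus of
            \<open>W\<close>: at most \<open>card V + k - (card W + k + 1) = card U - card W\<close>
            clauses remain.\<close>
          then have "card (U - W) < card (touch ?G (U - W))"
            using False WU U F' by (intro lean_on_card) auto
          also have "\<dots> \<le> card (touch F V - touch F W)"
            using finF U by (intro card_mono) (auto simp: touch_def F'_def)
          also have "\<dots> = card (touch F V) - card (touch F W)"
            using finF WU U by (intro card_Diff_subset touch_mono) auto
          finally show False
            using sW cardT U WU card_Diff_subset[of W U] finite_subset[of W U] by simp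
        qed
      qed
      moreover have "card U < card V" using U by simp
      ultimately obtain w where w: "w \<in> U" "vdeg F' w \<le> Nfun (card (touch F' U) - card U)"
        using less.hyps[of U F'] F' U False by blast
      define e where "e = ld F x"
      have e: "e = card {C \<in> F. x \<in> C}" by (simp add: e_def ld_def)
      have "card U < card (touch F' U)"
        using \<open>lean_on F' U\<close> F' U False by (intro lean_on_card) auto
      moreover have "card (touch F' U) \<le> card (touch F V) - e"
      proof -
        have "{C \<in> F. x \<in> C} \<subseteq> touch F V"
          using x v by (auto simp: touch_def cvar_def)
        then have "card (touch F V) - e = card (touch F V - {C \<in> F. x \<in> C})"
          using finF unfolding e by (intro card_Diff_subset[symmetric]) auto
        then show ?thesis
          using finF U by (auto simp: touch_def F'_def intro!: card_mono)
      qed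
      ultimately have k': "1 \<le> card (touch F' U) - card U" and le: "card (touch F' U) - card U \<le> k - e + 1"
        and ek: "e \<le> k"
        using cardT U by auto
      have "vdeg F w \<le> vdeg F' w + e"
      proof -
        have "touch F {w} \<subseteq> touch F' {w} \<union> {C \<in> F. x \<in> C}"
          by (auto simp: touch_def F'_def)
        then have "card (touch F {w}) \<le> card (touch F' {w} \<union> {C \<in> F. x \<in> C})"
          using F' finF by (intro card_mono) auto
        also have "\<dots> \<le> card (touch F' {w}) + e" unfolding e by (rule card_Un_le)
        finally show ?thesis using F F' by (simp add: vdeg_eq_card_touch)
      qed
      also have "vdeg F' w \<le> Nfun (k - e + 1)"
        using w(2) Nfun_mono[OF k' le] by simp
      finally have degw: "vdeg F w \<le> Nfun (k - e + 1) + e" by simp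
      show ?thesis
      proof (cases "2 \<le> e")
        case True
        have "vdeg F v \<le> Nfun k \<or> vdeg F w \<le> Nfun k"
          using Nfun_ge[OF True ek] degw x(2) unfolding e_def[symmetric] by linarith
        then show ?thesis using v w U by auto
      next
        case False
        \<comment> \<open>For \<open>e\<close> at most 1, which the recursion does not cover, the
          degree of \<open>v\<close> is at most 2.\<close>
        then have "vdeg F v \<le> Nfun k" using x(2) Nfun_ge_Suc[OF k] k by (simp add: e_def)
        then show ?thesis using v by blast
      qed
    qed
  qed
qed

section \<open>Transfer to clause-sets in \<open>LEAN\<close>\<close>

lemma finite_var: "is_clauseset F \<Longrightarrow> finite (var F)"
  by (simp add: is_clauseset_def is_clause_def var_def cvar_def)

text \<open>Cutting the total valuation down to \<open>W\<close> gives a partial assignment with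
  domain \<open>W\<close>, which is an autarky in the original sense.\<close>

lemma LEAN_imp_lean_on:
  assumes "F \<in> LEAN"
  shows "lean_on F (var F)"
  unfolding lean_on_def
proof (intro allI impI notI)
  fix W assume W: "W \<subseteq> var F \<and> W \<noteq> {}" and "autarky_on F W"
  then obtain f where f: "\<And>C. C \<in> touch F W \<Longrightarrow> \<exists>x\<in>C. lvar x \<in> W \<and> makes_true f x"
    by (auto simp: autarky_on_def)
  let ?\<phi> = "\<lambda>v. if v \<in> W then Some (f v) else None"
  have sat: "lit_sat ?\<phi> x \<longleftrightarrow> lvar x \<in> W \<and> makes_true f x" for x by (cases x) auto
  have fals: "lit_fals ?\<phi> x \<Longrightarrow> lvar x \<in> W" for x by (cases x) (auto split: if_splits)
  have "finite W" using W finite_var[of F] assms finite_subset by (auto simp: LEAN_def)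
  moreover have dom: "dom ?\<phi> = W" by (auto split: if_splits)
  moreover have "\<exists>x\<in>C. lit_sat ?\<phi> x" if "C \<in> F" "x \<in> C" "lit_fals ?\<phi> x" for C x
    using f[of C] fals[OF that(3)] that(1,2) unfolding sat touch_def cvar_def by blast
  ultimately have "autarky ?\<phi> F"
    unfolding autarky_def is_pass_def by auto
  then have "dom ?\<phi> \<inter> var F = {}" using assms unfolding LEAN_def by blast
  then show False using W unfolding dom by blast
qed

lemma LEAN_minvdeg_le:
  assumes "F \<in> LEAN" "deficiency F = int k" "nvar F > 0"
  shows "minvdeg F \<le> Nfun k"
proof -
  have F: "is_clauseset F" "finite F" using assms(1) by (auto simp: LEAN_def is_clauseset_def)
  have V: "finite (var F)" "var F \<noteq> {}" using F finite_var assms(3) by (auto simp: nvar_def)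
  note lean = LEAN_imp_lean_on[OF assms(1)]
  obtain v where v: "v \<in> var F" "vdeg F v \<le> Nfun (card (touch F (var F)) - card (var F))"
    using lean_on_min_vdeg[OF F(1) V lean] by blast
  \<comment> \<open>Only the empty clause can be missed, so the deficiency of the pair is at most
    \<open>k\<close>.\<close>
  have "card (touch F (var F)) \<le> card F" using F touch_subset by (intro card_mono) auto
  then have "Nfun (card (touch F (var F)) - card (var F)) \<le> Nfun k"
    using lean_on_card[OF F(2) V lean] assms(2)
    by (intro Nfun_mono) (auto simp: deficiency_def ncl_def nvar_def)
  moreover have "minvdeg F \<le> vdeg F v" unfolding minvdeg_def using v V by (intro Min_le) auto
  ultimately show ?thesis using v(2) by linarith
qed

subsection \<open>Sharpness\<close>

text \<open>For \<open>A \<subseteq> {..n}\<close> the set \<open>A\<close> lists the positive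
  variables, so the clauses over all of \<open>{..n}\<close> correspond to subsets.\<close>

definition full_clause :: "nat \<Rightarrow> nat set \<Rightarrow> clause" where
  "full_clause n A = Pos ` A \<union> Neg ` ({..n} - A)"

definition sharp_cls :: "nat \<Rightarrow> nat set set \<Rightarrow> cls" where
  "sharp_cls n S = insert {Neg 0} (full_clause n ` S)"

lemma cvar_full_clause: "A \<subseteq> {..n} \<Longrightarrow> cvar (full_clause n A) = {..n}"
  by (auto simp: cvar_def full_clause_def image_Un image_image)

lemma is_clause_full_clause: "A \<subseteq> {..n} \<Longrightarrow> is_clause (full_clause n A)"
  by (auto simp: is_clause_def full_clause_def image_Un image_image finite_subset)

lemma inj_full_clause: "inj (full_clause n)"
proof (rule injI)
  fix A B assume "full_clause n A = full_clause n B"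
  then have "Pos -` full_clause n A = Pos -` full_clause n B" by simp
  moreover have "Pos -` full_clause n X = X" for X by (auto simp: full_clause_def)
  ultimately show "A = B" by simp
qed

text \<open>The forced sets in \<open>S\<close> guarantee unsatisfiability; the others only adjust
  the deficiency. The bound on \<open>n\<close> keeps the unit clause distinct from the full
  ones.\<close>

locale sharp_example =
  fixes n :: nat and S :: "nat set set"
  assumes n: "1 \<le> n" and S: "{A. A \<subseteq> {..n} \<and> 0 \<in> A} \<subseteq> S" "S \<subseteq> Pow {..n}"
begin

abbreviation "F \<equiv> sharp_cls n S"

lemma finite_S: "finite S"
  using finite_subset[OF S(2)] by simp

lemma is_clauseset_F: "is_clauseset F"
  using S(2) finite_S
  by (auto simp: is_clauseset_def sharp_cls_def is_clause_full_clause is_clause_def[of "{Neg 0}"])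

lemma card_full: "card (full_clause n ` S) = card S"
  by (intro card_image inj_on_subset[OF inj_full_clause]) simp

lemma var_F: "var F = {..n}"
  using S by (auto simp: var_def sharp_cls_def cvar_full_clause cvar_def[of "{Neg 0}"] subset_iff)

lemma card_F: "card F = Suc (card S)"
proof -
  have "{Neg 0} \<notin> full_clause n ` S"
  proof
    assume "{Neg 0} \<in> full_clause n ` S"
    then obtain A where "A \<in> S" "{Neg 0} = full_clause n A" by blast
    then have "cvar {Neg 0} = {..n}" using S(2) cvar_full_clause[of A n] by auto
    then have "n \<in> cvar {Neg 0}" by simp
    then show False using n by (simp add: cvar_def)
  qed
  then show ?thesis using finite_S by (simp add: sharp_cls_def card_full)
qed

lemma deficiency_F: "deficiency F = int (card S) - int n"
  by (simp add: deficiency_def ncl_def nvar_def card_F var_F)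

lemma full_subset_touch:
  assumes "V \<noteq> {}" "V \<subseteq> {..n}"
  shows "full_clause n ` S \<subseteq> touch F V"
proof
  fix C assume "C \<in> full_clause n ` S"
  then obtain A where "A \<in> S" "C = full_clause n A" by blast
  then have "cvar C = {..n}" "C \<in> F" using S(2) by (auto simp: cvar_full_clause sharp_cls_def)
  then show "C \<in> touch F V" using assms by (auto simp: touch_def)
qed

lemma touch_F:
  assumes "0 \<in> V" "V \<subseteq> {..n}"
  shows "touch F V = F"
proof -
  have "{Neg 0} \<in> touch F V" using assms by (simp add: touch_def sharp_cls_def cvar_def)
  then show ?thesis
    using full_subset_touch[of V] assms touch_subset[of F V] unfolding sharp_cls_def by blast
qed

lemma card_le_card_touch:
  assumes "V \<noteq> {}" "V \<subseteq> {..n}"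
  shows "card S \<le> card (touch F V)"
  using card_mono[OF _ full_subset_touch[OF assms]] is_clauseset_F card_full
  by (simp add: is_clauseset_def)

lemma unsatisfiable_F: "\<not> satisfiable F"
proof
  assume "satisfiable F"
  then obtain \<phi> where \<phi>: "\<forall>C\<in>F. \<exists>x\<in>C. lit_sat \<phi> x" by (auto simp: satisfiable_def)
  \<comment> \<open>The full clause of \<open>?A\<close> is falsified or left undecided everywhere,
    and the unit clause forces 0 into \<open>?A\<close>.\<close>
  let ?A = "{v. v \<le> n \<and> \<phi> v \<noteq> Some True}"
  have "0 \<in> ?A" using \<phi> by (auto simp: sharp_cls_def)
  then have "full_clause n ?A \<in> F" using S(1) by (auto simp: sharp_cls_def)
  moreover have "\<not> lit_sat \<phi> x" if "x \<in> full_clause n ?A" for x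
    using that by (auto simp: full_clause_def)
  ultimately show False using \<phi> by blast
qed

text \<open>The unit clause alone is satisfiable, so an unsatisfiable subset contains a full clause
  and hence all variables.\<close>

lemma F_in_VMU: "F \<in> VMU"
proof -
  have "var F' = var F" if F': "F' \<subseteq> F" "\<not> satisfiable F'" for F'
  proof -
    have "\<not> F' \<subseteq> {{Neg 0}}"
    proof
      assume "F' \<subseteq> {{Neg 0}}"
      then have "satisfiable F'"
        unfolding satisfiable_def is_pass_def
        by (intro exI[of _ "[0 \<mapsto> False]"] conjI ballI) auto
      then show False using F'(2) by contradiction
    qed
    then obtain A where "A \<in> S" "full_clause n A \<in> F'" using F'(1) unfolding sharp_cls_def by blast
    moreover from this have "cvar (full_clause n A) = {..n}" using S(2) cvar_full_clause by blast
    ultimately have "{..n} \<subseteq> var F'" unfolding var_def by blast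
    moreover have "var F' \<subseteq> var F" using F'(1) by (auto simp: var_def)
    ultimately show ?thesis using var_F by auto
  qed
  then show ?thesis using is_clauseset_F unsatisfiable_F unfolding VMU_def by blast
qed

lemma F_in_SED: "F \<in> SED"
proof -
  let ?M = "{int (card {C\<in>F. cvar C \<inter> V \<noteq> {}}) - int (card V) | V. V \<noteq> {} \<and> V \<subseteq> var F}"
  have "Min ?M = deficiency F"
  proof (rule Min_eqI)
    have "?M = (\<lambda>V. int (card {C\<in>F. cvar C \<inter> V \<noteq> {}}) - int (card V)) ` {V. V \<noteq> {} \<and> V \<subseteq> var F}"
      by auto
    then show "finite ?M" by (simp add: var_F)
  next
    fix y assume "y \<in> ?M"
    then obtain V where V: "V \<noteq> {}" "V \<subseteq> {..n}" and y: "y = int (card (touch F V)) - int (card V)"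
      by (auto simp: var_F touch_def)
    \<comment> \<open>Leaving 0 out of \<open>V\<close> loses at most the unit clause, but also
      lowers the largest possible \<open>card V\<close> from \<open>n + 1\<close> to
      \<open>n\<close>.\<close>
    show "deficiency F \<le> y"
    proof (cases "0 \<in> V")
      case True
      then have "touch F V = F" using V by (intro touch_F) auto
      then show ?thesis using card_mono[OF _ V(2)] y by (simp add: card_F deficiency_F)
    next
      case False
      then have "V \<subseteq> {1..n}" using V by (auto simp: Suc_le_eq intro!: gr0I)
      then have "card V \<le> n" using card_mono[of "{1..n}" V] by simp
      then show ?thesis using card_le_card_touch[OF V] y by (simp add: deficiency_F)
    qed
  next
    have "{C\<in>F. cvar C \<inter> {..n} \<noteq> {}} = F"
      using touch_F[of "{..n}"] by (simp add: touch_def)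
    then show "deficiency F \<in> ?M"
      unfolding deficiency_def nvar_def ncl_def var_F
      by (intro CollectI exI[of _ "{..n}"]) simp
  qed
  then show ?thesis
    using is_clauseset_F by (simp add: SED_def surplus_def nvar_def var_F)
qed

lemma minvdeg_F_ge: "card S \<le> minvdeg F"
  unfolding minvdeg_def var_F
  by (subst Min_ge_iff) (auto simp: vdeg_eq_card_touch[OF is_clauseset_F] intro!: card_le_card_touch)

end

section \<open>Choice of the parameters\<close>

lemma card_Pow_containing_0: "card {A. A \<subseteq> {..n} \<and> (0::nat) \<in> A} = 2 ^ n"
proof -
  have "{A. A \<subseteq> {..n} \<and> (0::nat) \<in> A} = insert 0 ` Pow {1..n}"
  proof (intro equalityI subsetI)
    fix A assume A: "A \<in> {A. A \<subseteq> {..n} \<and> (0::nat) \<in> A}"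
    then have "A = insert 0 (A - {0})" "A - {0} \<in> Pow {1..n}"
      by (auto simp: Suc_le_eq)
    then show "A \<in> insert 0 ` Pow {1..n}" by blast
  qed auto
  moreover have "inj_on (insert (0::nat)) (Pow {1..n})"
  proof (rule inj_onI)
    fix A B assume "A \<in> Pow {1..n}" "B \<in> Pow {1..n}" and eq: "insert 0 A = insert 0 B"
    then have "0 \<notin> A" "0 \<notin> B" by auto
    with eq show "A = B" by (simp add: insert_ident)
  qed
  ultimately show ?thesis by (simp add: card_image card_Pow)
qed

text \<open>The lower bound leaves room for all forced full clauses; the upper one is the hypothesis
  of \<open>Nfun_le_add\<close> and ensures that enough full clauses exist. The least
  \<open>n\<close> with the upper bound also has the lower one.\<close>

lemma obtain_level:
  assumes "1 \<le> k"
  obtains n :: nat where "1 \<le> n" "2 ^ n \<le> k + n" "k + n + 2 \<le> 2 ^ (n + 1)"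
proof -
  let ?P = "\<lambda>n. 1 \<le> n \<and> k + n + 2 \<le> 2 ^ (n + 1)"
  define n where "n = (LEAST n. ?P n)"
  have "2 * (k + 1) \<le> 2 * 2 ^ k" using less_exp[of k] by (intro mult_le_mono2) linarith
  then have "?P k" using assms by simp
  then have P: "?P n" unfolding n_def by (rule LeastI)
  moreover have "2 ^ n \<le> k + n"
  proof (cases "n = 1")
    case False
    then obtain m where m: "n = Suc m" "1 \<le> m" using P by (cases n) auto
    \<comment> \<open>Failure at \<open>m = n - 1\<close> reads \<open>2 ^ n < k + n + 1\<close>,
      which is the lower bound.\<close>
    then have "\<not> ?P m" unfolding n_def by (intro not_less_Least) simp
    then show ?thesis using m by simp
  qed (use assms in simp)
  ultimately show ?thesis using that by blast
qed

lemma VMU_SED_sharp: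
  assumes "1 \<le> k"
  shows "\<exists>F \<in> VMU \<inter> SED. deficiency F = int k \<and> nvar F > 0 \<and> Nfun k \<le> minvdeg F"
proof -
  obtain n :: nat where n: "1 \<le> n" "2 ^ n \<le> k + n" "k + n + 2 \<le> 2 ^ (n + 1)"
    using obtain_level[OF assms] .
  have "\<exists>S. {A. A \<subseteq> {..n} \<and> 0 \<in> A} \<subseteq> S \<and> S \<subseteq> Pow {..n} \<and> card S = k + n"
    using n by (intro exists_subset_between) (auto simp: card_Pow_containing_0 card_Pow)
  then obtain S where S: "{A. A \<subseteq> {..n} \<and> 0 \<in> A} \<subseteq> S" "S \<subseteq> Pow {..n}" "card S = k + n"
    by blast
  interpret ex: sharp_example n S using n S by unfold_locales auto
  have "Nfun k \<le> minvdeg (sharp_cls n S)"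
    using Nfun_le_add[OF assms n(1,3)] ex.minvdeg_F_ge S(3) by simp
  then show ?thesis
    using ex.F_in_VMU ex.F_in_SED ex.deficiency_F S(3)
    by (intro bexI[of _ "sharp_cls n S"]) (auto simp: nvar_def ex.var_F)
qed

theorem theorem9p14:
  fixes \<C> :: "cls set" and k :: nat
  assumes "VMU \<inter> SED \<subseteq> \<C>" and "\<C> \<subseteq> LEAN" and "k \<ge> 1"
  shows "minvdeg_class {F \<in> \<C>. deficiency F = int k} = enat (Nfun k)"
proof (rule antisym)
  show "minvdeg_class {F \<in> \<C>. deficiency F = int k} \<le> enat (Nfun k)"
    unfolding minvdeg_class_def using assms(2) LEAN_minvdeg_le by (intro Sup_least) auto
  obtain F where F: "F \<in> \<C>" "deficiency F = int k" "nvar F > 0" "Nfun k \<le> minvdeg F"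
    using VMU_SED_sharp[OF assms(3)] assms(1) by blast
  then have "enat (minvdeg F) \<le> minvdeg_class {F \<in> \<C>. deficiency F = int k}"
    unfolding minvdeg_class_def by (intro Sup_upper) auto
  then show "enat (Nfun k) \<le> minvdeg_class {F \<in> \<C>. deficiency F = int k}"
    using F(4) order_trans enat_ord_simps(1) by blast
qed

end
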